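(* Let $P$ be a Horn mca-program and let $M \subseteq \mathit{At}$ be a model of $P$. Define $X_0 = \emptyset$ and, for every $n \geq 0$, $X_{n+1} = \mathit{hset}(P(X_n)) \cap M$. Then the sequence $(X_n)_{n=0,1,\ldots}$ is a $P$-computation.
   Context: Let $\mathit{At}$ be a set of propositional atoms. An mc-atom over $\mathit{At}$ is an expression $kX$, where $k$ is a non-negative integer and $X \subseteq \mathit{At}$ is finite with $k \leq |X|$; $\mathit{aset}(kX) = X$. An mc-literal is $A$ or $\mathbf{not}(A)$ for an mc-atom $A$. An mca-clause $r$ is an expression $H \leftarrow L_1, \ldots, L_m$ ($m \geq 0$), where $H$ is an mc-atom and the $L_i$ are mc-literals, with $\mathit{hd}(r) = H$, $\mathit{bd}(r) = \{L_1, \ldots, L_m\}$, and $\mathit{hset}(r) = \mathit{aset}(H)$. An mca-program is a set of mca-clauses. It is Horn if no clause body contains a literal of the form $\mathbf{not}(A)$. For a set $Q$ of clauses, $\mathit{hset}(Q) = \bigcup\{\mathit{hset}(r) : r \in Q\}$. Satisfaction, for $M \subseteq \mathit{At}$: - $M \models kX$ iff $|M \cap X| \geq k$. - $M \models \mathbf{not}(kX)$ iff $|M \cap X| < k$. - $M \models \mathit{bd}(r)$ iff $M$ satisfies all literals of $\mathit{bd}(r)$. - $M$ satisfies $r$ if $M \models \mathit{hd}(r)$ whenever $M \models \mathit{bd}(r)$. - $M$ is a model of $P$ if it satisfies all clauses of $P$. Operators: - $P(M) = \{r \in P : M \models \mathit{bd}(r)\}$. - $T^{\mathit{nd}}_P(M)$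 is the set of all $M'$ with $M' \subseteq \mathit{hset}(P(M))$ and $M' \models \mathit{hd}(r)$ for all $r \in P(M)$. A $P$-computation (for Horn $P$) is a sequence $(X_n)_{n \geq 0}$ with $X_0 = \emptyset$ and, for every $n$, $X_n \subseteq X_{n+1}$ and $X_{n+1} \in T^{\mathit{nd}}_P(X_n)$. *)

theory Defs
  imports Main
begin

text \<open>
  The set \<open>At\<close> of propositional atoms is an arbitrary (possibly empty or infinite)
  set over a type \<open>'a\<close>. The datatypes below give raw syntax; the predicates
  \<open>is_mc_atom\<close>, \<open>is_mc_literal\<close>, \<open>is_mca_clause\<close> and \<open>is_mca_program\<close> select the
  expressions that are well-formed over \<open>At\<close>.
\<close>

datatype 'a mc_atom = MC (bound: nat) (aset: "'a set")

datatype 'a mc_literal = Pos "'a mc_atom" | Naf "'a mc_atom"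

datatype 'a mca_clause = Clause (head: "'a mc_atom") (body: "'a mc_literal list")

definition is_mc_atom :: "'a set \<Rightarrow> 'a mc_atom \<Rightarrow> bool" where
  "is_mc_atom At A \<longleftrightarrow> finite (aset A) \<and> aset A \<subseteq> At \<and> bound A \<le> card (aset A)"

fun is_mc_literal :: "'a set \<Rightarrow> 'a mc_literal \<Rightarrow> bool" where
  "is_mc_literal At (Pos A) \<longleftrightarrow> is_mc_atom At A"
| "is_mc_literal At (Naf A) \<longleftrightarrow> is_mc_atom At A"

definition bd :: "'a mca_clause \<Rightarrow> 'a mc_literal set" where
  "bd r = set (body r)"

definition is_mca_clause :: "'a set \<Rightarrow> 'a mca_clause \<Rightarrow> bool" where
  "is_mca_clause At r \<longleftrightarrow> is_mc_atom At (head r) \<and> (\<forall>L\<in>bd r. is_mc_literal At L)"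

definition is_mca_program :: "'a set \<Rightarrow> 'a mca_clause set \<Rightarrow> bool" where
  "is_mca_program At P \<longleftrightarrow> (\<forall>r\<in>P. is_mca_clause At r)"

definition horn :: "'a mca_clause set \<Rightarrow> bool" where
  "horn P \<longleftrightarrow> (\<forall>r\<in>P. \<forall>A. Naf A \<notin> bd r)"

definition hset :: "'a mca_clause \<Rightarrow> 'a set" where
  "hset r = aset (head r)"

definition hsets :: "'a mca_clause set \<Rightarrow> 'a set" where
  "hsets Q = (\<Union>r\<in>Q. hset r)"

text \<open>
  On well-formed mc-atoms \<open>aset A\<close> is finite, so \<open>card\<close> below is the true cardinality
  even when \<open>M\<close> is infinite.
\<close>

definition sat_atom :: "'a set \<Rightarrow> 'a mc_atom \<Rightarrow> bool" where
  "sat_atom M A \<longleftrightarrow> card (M \<inter> aset A) \<ge> bound A"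

fun sat_literal :: "'a set \<Rightarrow> 'a mc_literal \<Rightarrow> bool" where
  "sat_literal M (Pos A) \<longleftrightarrow> sat_atom M A"
| "sat_literal M (Naf A) \<longleftrightarrow> card (M \<inter> aset A) < bound A"

definition sat_body :: "'a set \<Rightarrow> 'a mca_clause \<Rightarrow> bool" where
  "sat_body M r \<longleftrightarrow> (\<forall>L\<in>bd r. sat_literal M L)"

definition sat_clause :: "'a set \<Rightarrow> 'a mca_clause \<Rightarrow> bool" where
  "sat_clause M r \<longleftrightarrow> (sat_body M r \<longrightarrow> sat_atom M (head r))"

definition is_model :: "'a set \<Rightarrow> 'a mca_clause set \<Rightarrow> bool" where
  "is_model M P \<longleftrightarrow> (\<forall>r\<in>P. sat_clause M r)"

definition applicable :: "'a mca_clause set \<Rightarrow> 'a set \<Rightarrow> 'a mca_clause set" where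
  "applicable P M = {r \<in> P. sat_body M r}"

definition Tnd :: "'a mca_clause set \<Rightarrow> 'a set \<Rightarrow> 'a set set" where
  "Tnd P M = {M'. M' \<subseteq> hsets (applicable P M) \<and> (\<forall>r\<in>applicable P M. sat_atom M' (head r))}"

definition P_computation :: "'a mca_clause set \<Rightarrow> (nat \<Rightarrow> 'a set) \<Rightarrow> bool" where
  "P_computation P X \<longleftrightarrow>
     X 0 = {} \<and> (\<forall>n. X n \<subseteq> X (Suc n) \<and> X (Suc n) \<in> Tnd P (X n))"

end

(* Bodies of Horn clauses are monotone, so the sequence increases and stays below M.
   Every clause applicable in X n is thus applicable in the model M, which satisfies its
   head H; and X (n + 1) agrees with M on the atoms of H. *)
theory Submission
  imports Defs
begin

text \<open>Finiteness is essential: \<open>card\<close> is 0 on infinite sets, so enlarging an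
  intersection could otherwise lower its \<open>card\<close>.\<close>

lemma sat_atom_mono:
  assumes "sat_atom M A" "M \<subseteq> N" "finite (aset A)"
  shows "sat_atom N A"
proof -
  have "card (M \<inter> aset A) \<le> card (N \<inter> aset A)"
    using assms(2,3) by (intro card_mono) auto
  then show ?thesis
    using assms(1) by (simp add: sat_atom_def)
qed

text \<open>The Horn condition leaves only \<open>Pos\<close> literals in the body, and
  well-formedness makes their atom sets finite, so \<open>sat_atom_mono\<close> applies to each
  literal.\<close>

lemma horn_sat_body_mono:
  assumes "is_mca_program At P" "horn P" "r \<in> P" "sat_body M r" "M \<subseteq> N"
  shows "sat_body N r"
  unfolding sat_body_def
proof
  fix L
  assume L: "L \<in> bd r"
  then obtain A where A: "L = Pos A"
    using assms(2,3) by (cases L) (auto simp: horn_def)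
  have "finite (aset A)"
    using assms(1,3) L A by (force simp: is_mca_program_def is_mca_clause_def is_mc_atom_def)
  moreover have "sat_atom M A"
    using assms(4) L A by (auto simp: sat_body_def)
  ultimately show "sat_literal N L"
    using A assms(5) by (auto intro: sat_atom_mono)
qed

lemma horn_applicable_mono:
  assumes "is_mca_program At P" "horn P" "M \<subseteq> N"
  shows "applicable P M \<subseteq> applicable P N"
  using horn_sat_body_mono[OF assms(1,2) _ _ assms(3)] by (auto simp: applicable_def)

lemma hsets_mono: "Q \<subseteq> R \<Longrightarrow> hsets Q \<subseteq> hsets R"
  by (auto simp: hsets_def)

lemma model_inter_hsets_in_Tnd:
  assumes "is_mca_program At P" "horn P" "is_model M P" "N \<subseteq> M"
  shows "hsets (applicable P N) \<inter> M \<in> Tnd P N"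
proof -
  have "sat_atom (hsets (applicable P N) \<inter> M) (head r)" if r: "r \<in> applicable P N" for r
  proof -
    have "r \<in> applicable P M"
      using horn_applicable_mono[OF assms(1,2,4)] r by blast
    then have "sat_atom M (head r)"
      using assms(3) by (auto simp: applicable_def is_model_def sat_clause_def)
    \<comment> \<open>As \<open>r\<close> is applicable in \<open>N\<close>, its head atoms all lie
      in \<open>hsets (applicable P N)\<close>; the restriction removes none of them.\<close>
    moreover have "hsets (applicable P N) \<inter> M \<inter> aset (head r) = M \<inter> aset (head r)"
      using r by (auto simp: hsets_def hset_def)
    ultimately show ?thesis
      by (simp add: sat_atom_def)
  qed
  then show ?thesis
    by (auto simp: Tnd_def)
qed

theorem theorem2:
  fixes At M :: "'a set" and P :: "'a mca_clause set" and X :: "nat \<Rightarrow> 'a set"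
  assumes "is_mca_program At P" and "horn P"
    and "M \<subseteq> At" and "is_model M P"
    and "X 0 = {}"
    and "\<And>n. X (Suc n) = hsets (applicable P (X n)) \<inter> M"
  shows "P_computation P X"
proof -
  have "X n \<subseteq> X (Suc n)" for n
  proof (induction n)
    case 0
    then show ?case by (simp add: assms(5))
  next
    case (Suc n)
    \<comment> \<open>The induction hypothesis passes through \<open>applicable\<close> and
      \<open>hsets\<close>; intersecting both sides with \<open>M\<close> keeps the
      inclusion.\<close>
    from hsets_mono[OF horn_applicable_mono[OF assms(1,2) Suc]]
    show ?case unfolding assms(6) by blast
  qed
  moreover have "X n \<subseteq> M" for n
    \<comment> \<open>A case split suffices: each successor term is an intersection with
      \<open>M\<close>.\<close>
    by (cases n) (auto simp: assms(5,6))
  then have "X (Suc n) \<in> Tnd P (X n)" for n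
    unfolding assms(6) by (intro model_inter_hsets_in_Tnd[OF assms(1,2,4)])
  ultimately show ?thesis
    by (simp add: P_computation_def assms(5))
qed

end
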